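(* Let $f,g\in L^1(\mathbb{R}^N)$. Then for all $\boldsymbol{\omega}\in\mathbb{R}^N$, $$\mathcal{Q}_{\boldsymbol{\Lambda}}(f\otimes g)(\boldsymbol{\omega})=e^{-i\sum_{k=1}^N(c_k\omega_k^2+e_k\omega_k)}\,(\mathcal{Q}_{\boldsymbol{\Lambda}}g)(\boldsymbol{\omega})\,(\mathcal{Q}_{\boldsymbol{\Lambda}}f)(\boldsymbol{\omega}).$$
   Context: Let $N\ge 1$ and $\boldsymbol{\Lambda}=(\Lambda_1,\dots,\Lambda_N)$ with $\Lambda_k=(a_k,b_k,c_k,d_k,e_k)\in\mathbb{R}^5$ and $b_k\neq 0$ for $k=1,\dots,N$. The kernel is $$\mathcal{K}_{\boldsymbol{\Lambda}}(\boldsymbol{\omega},\boldsymbol{x})=\prod_{k=1}^N\sqrt{\tfrac{b_k}{2\pi i}}\;e^{i(a_kx_k^2+b_kx_k\omega_k+c_k\omega_k^2+d_kx_k+e_k\omega_k)},\qquad \boldsymbol{\omega},\boldsymbol{x}\in\mathbb{R}^N,$$ with principal square roots. The multidimensional QPFT of $f\in L^1(\mathbb{R}^N)$ is $(\mathcal{Q}_{\boldsymbol{\Lambda}}f)(\boldsymbol{\omega})=\int_{\mathbb{R}^N}\mathcal{K}_{\boldsymbol{\Lambda}}(\boldsymbol{\omega},\boldsymbol{x})f(\boldsymbol{x})\,d\boldsymbol{x}$. For $u,v\in L^1(\mathbb{R}^N)$ put $(u\star v)(\boldsymbol{x})=\frac{1}{(\sqrt{2\pi})^N}\int_{\mathbb{R}^N}u(\boldsymbol{\tau})v(\boldsymbol{x}-\boldsymbol{\tau})\,d\boldsymbol{\tau}$.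 For $f,g\in L^1(\mathbb{R}^N)$ define $$(f\otimes g)(\boldsymbol{x})=\Big(\prod_{k=1}^N\sqrt{\tfrac{b_k}{i}}\Big)\,e^{-i\sum_{k}a_kx_k^2}\,\Big(\big(f\,\phi\big)\star\big(g\,\phi\big)\Big)(\boldsymbol{x}),\qquad \phi(\boldsymbol{y})=e^{i\sum_{k=1}^Na_ky_k^2}.$$ *)

theory Defs
  imports "HOL-Analysis.Analysis"
begin

record qpft_param =
  pa :: real
  pb :: real
  pc :: real
  pd :: real
  pe :: real

(* The dimension N is CARD('n), and \<Lambda>_k is \<Lambda> k. Since b_k / i is purely imaginary and
   nonzero, the convention for csqrt on the negative real axis plays no role. *)
definition qpft_kernel :: "('n::finite \<Rightarrow> qpft_param) \<Rightarrow> real ^ 'n \<Rightarrow> real ^ 'n \<Rightarrow> complex" where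
  "qpft_kernel \<Lambda> \<omega> x =
     (\<Prod>k\<in>UNIV. csqrt (of_real (pb (\<Lambda> k)) / (2 * of_real pi * \<i>)) *
        exp (\<i> * of_real (pa (\<Lambda> k) * (x $ k)\<^sup>2 + pb (\<Lambda> k) * (x $ k) * (\<omega> $ k)
             + pc (\<Lambda> k) * (\<omega> $ k)\<^sup>2 + pd (\<Lambda> k) * (x $ k) + pe (\<Lambda> k) * (\<omega> $ k))))"

definition qpft :: "('n::finite \<Rightarrow> qpft_param) \<Rightarrow> (real ^ 'n \<Rightarrow> complex) \<Rightarrow> real ^ 'n \<Rightarrow> complex" where
  "qpft \<Lambda> f \<omega> = (LINT x|lebesgue. qpft_kernel \<Lambda> \<omega> x * f x)"

(* For integrable u and v the integral converges for almost every x only; at the exceptional points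
   the value is 0, the Bochner integral of a non-integrable function. *)
definition convol :: "(real ^ 'n::finite \<Rightarrow> complex) \<Rightarrow> (real ^ 'n \<Rightarrow> complex) \<Rightarrow> real ^ 'n \<Rightarrow> complex" where
  "convol u v x =
     1 / of_real (sqrt (2 * pi) ^ CARD('n)) * (LINT \<tau>|lebesgue. u \<tau> * v (x - \<tau>))"

definition chirp :: "('n::finite \<Rightarrow> qpft_param) \<Rightarrow> real ^ 'n \<Rightarrow> complex" where
  "chirp \<Lambda> y = exp (\<i> * of_real (\<Sum>k\<in>UNIV. pa (\<Lambda> k) * (y $ k)\<^sup>2))"

definition qpft_convol ::
  "('n::finite \<Rightarrow> qpft_param) \<Rightarrow> (real ^ 'n \<Rightarrow> complex) \<Rightarrow> (real ^ 'n \<Rightarrow> complex) \<Rightarrow> real ^ 'n \<Rightarrow> complex" where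
  "qpft_convol \<Lambda> f g x =
     (\<Prod>k\<in>UNIV. csqrt (of_real (pb (\<Lambda> k)) / \<i>)) *
     exp (- \<i> * of_real (\<Sum>k\<in>UNIV. pa (\<Lambda> k) * (x $ k)\<^sup>2)) *
     convol (\<lambda>y. f y * chirp \<Lambda> y) (\<lambda>y. g y * chirp \<Lambda> y) x"

end

theory Submission
  imports Defs
begin

text \<open>
  Why the theorem holds.  As a function of \<open>x\<close>, the kernel is a constant multiple of
  \<open>chirp \<Lambda> x * fourier_char \<Lambda> \<omega> x\<close>: the quadratic phase \<open>\<Sum>k. a\<^sub>k x\<^sub>k\<^sup>2\<close> splits off, and the phase
  that remains is linear in \<open>x\<close>, hence \<open>fourier_char \<Lambda> \<omega>\<close> is a character of the additive group.
  The outer exponential in the definition of the convolution \<open>qpft_convol\<close> cancels the chirp of the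
  kernel, and its inner factors multiply \<open>f\<close> and \<open>g\<close> by the chirp that the kernel would contribute
  to each of their transforms (\<open>qpft_eq_chirped\<close>).  What is left to show is the classical
  convolution theorem for the chirped functions: multiplying \<open>\<integral> u t * v (x - t) dt\<close>
  by the character at \<open>x\<close> gives the convolution of \<open>fourier_char * u\<close> and \<open>fourier_char * v\<close>, and the integral of a
  convolution is the product of the integrals by Fubini and translation invariance
  (\<open>integral_convolution_lebesgue\<close>).

  The remaining factors do not depend on \<open>x\<close>.  The left side contains the phase
  \<open>output_phase \<Lambda> \<omega>\<close> of the kernel once and the right side twice, which explains the inverse phase
  in the claim.  The square roots of the kernel occur twice on the right; on the left, the second
  copy comes from the definition of \<open>qpft_convol\<close>, because
  \<open>csqrt (b / \<i>) / sqrt (2 * pi) = csqrt (b / (2 * pi * \<i>))\<close> (\<open>kernel_const_eq\<close>).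

  The integrals are taken with respect to the completed Lebesgue measure.  For a merely Lebesgue
  measurable \<open>v\<close>, the function \<open>(x, t) \<mapsto> v (x - t)\<close> need not be measurable for the product of
  the completed \<open>\<sigma>\<close>-algebras, so Fubini does not apply directly.  For this reason \<open>f\<close> and \<open>g\<close> are
  first replaced by Borel functions that agree with them almost everywhere; this changes no value
  of the convolution, since reflections and translations preserve null sets.
\<close>

section \<open>The integral of a convolution\<close>

lemma distr_lborel_reflect:
  fixes x :: "'a::euclidean_space"
  shows "distr lborel borel (\<lambda>t. x - t) = lborel"
  using lborel_affine[of "-1" x] by (simp add: density_1)

lemma distr_lborel_translate:
  fixes t :: "'a::euclidean_space"
  shows "distr lborel borel (\<lambda>x. x - t) = lborel"
  using lborel_affine[of 1 "-t"] by (simp add: density_1)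

lemma integrable_lborel_translate:
  fixes g :: "'a::euclidean_space \<Rightarrow> 'b::{banach, second_countable_topology}"
  assumes "integrable lborel g"
  shows "integrable lborel (\<lambda>x. g (x - t))"
proof -
  have "integrable (distr lborel borel (\<lambda>x. x - t)) g"
    using assms by (simp add: distr_lborel_translate)
  then show ?thesis
    by (rule integrable_distr[rotated]) simp
qed

lemma integral_lborel_translate:
  fixes g :: "'a::euclidean_space \<Rightarrow> 'b::{banach, second_countable_topology}"
  assumes "g \<in> borel_measurable borel"
  shows "(LINT x|lborel. g (x - t)) = (LINT x|lborel. g x)"
  by (subst (2) distr_lborel_translate[of t, symmetric]) (simp add: integral_distr assms)

text \<open>
  Integrating over \<open>x\<close> first, translation invariance makes the inner integral independent of \<open>t\<close>.
  The same computation for the norms justifies the exchange of the integrals.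
\<close>

lemma integral_convolution_lborel:
  fixes f g :: "'a::euclidean_space \<Rightarrow> 'b::{real_normed_field, banach, second_countable_topology}"
  assumes f: "integrable lborel f" and g: "integrable lborel g"
  shows "(LINT x|lborel. LINT t|lborel. f t * g (x - t)) =
    (LINT t|lborel. f t) * (LINT x|lborel. g x)"
proof -
  have [measurable]: "f \<in> borel_measurable borel" "g \<in> borel_measurable borel"
    using borel_measurable_integrable[OF f] borel_measurable_integrable[OF g] by simp_all
  have "integrable (lborel \<Otimes>\<^sub>M lborel) (\<lambda>(t, x). f t * g (x - t))"
  proof (rule lborel_pair.Fubini_integrable)
    have "(LINT x|lborel. norm (f t * g (x - t))) = norm (f t) * (LINT x|lborel. norm (g x))" for t
      using integral_lborel_translate[of "\<lambda>x. norm (g x)" t] by (simp add: norm_mult)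
    then show "integrable lborel (\<lambda>t. LINT x|lborel. norm (case (t, x) of (t, x) \<Rightarrow> f t * g (x - t)))"
      using f by simp
    show "AE t in lborel. integrable lborel (\<lambda>x. case (t, x) of (t, x) \<Rightarrow> f t * g (x - t))"
      using integrable_lborel_translate[OF g] by simp
  qed measurable
  then have "(LINT x|lborel. LINT t|lborel. f t * g (x - t)) =
      (LINT t|lborel. LINT x|lborel. f t * g (x - t))"
    by (rule lborel_pair.Fubini_integral)
  also have "\<dots> = (LINT t|lborel. f t * (LINT x|lborel. g x))"
    using integrable_lborel_translate[OF g] by (simp add: integral_lborel_translate)
  finally show ?thesis
    using f by simp
qed

lemma borel_representative_complex:
  fixes f :: "'a \<Rightarrow> complex"
  assumes "f \<in> borel_measurable (completion M)"
  shows "\<exists>f'\<in>borel_measurable M. AE x in M. f x = f' x"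
proof -
  have "(\<lambda>x. Re (f x)) \<in> borel_measurable (completion M)"
    and "(\<lambda>x. Im (f x)) \<in> borel_measurable (completion M)"
    using assms by measurable
  then obtain r s where rs: "r \<in> borel_measurable M" "s \<in> borel_measurable M"
    "AE x in M. Re (f x) = r x" "AE x in M. Im (f x) = s x"
    using completion_ex_borel_measurable_real[of "\<lambda>x. Re (f x)" M]
      completion_ex_borel_measurable_real[of "\<lambda>x. Im (f x)" M] by blast
  show ?thesis
  proof
    show "(\<lambda>x. Complex (r x) (s x)) \<in> borel_measurable M"
      unfolding Complex_eq using rs(1,2) by measurable
    show "AE x in M. f x = Complex (r x) (s x)"
      using rs(3,4) by eventually_elim (simp add: complex_eq_iff)
  qed
qed

lemma AE_lborel_reflect:
  fixes x :: "'a::euclidean_space"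
  assumes "AE y in lborel. P y"
  shows "AE t in lborel. P (x - t)"
  using assms by (subst (asm) distr_lborel_reflect[of x, symmetric]) (auto dest: AE_distrD[rotated])

lemma borel_measurable_lebesgue_reflect:
  fixes g :: "'a::euclidean_space \<Rightarrow> 'b::topological_space"
  assumes "g \<in> borel_measurable lebesgue"
  shows "(\<lambda>t. g (x - t)) \<in> borel_measurable lebesgue"
proof -
  have "(\<lambda>t. x + (\<Sum>j\<in>Basis. (-1 * (t \<bullet> j)) *\<^sub>R j)) \<in> lebesgue \<rightarrow>\<^sub>M lebesgue"
    by (rule lebesgue_affine_measurable) simp
  then have "(\<lambda>t. x - t) \<in> lebesgue \<rightarrow>\<^sub>M lebesgue"
    by (simp add: sum_negf euclidean_representation)
  then show ?thesis
    using assms by (rule measurable_compose)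
qed

text \<open>
  The inner integral for \<open>f\<close>, \<open>g\<close> equals the one for Borel representatives at every \<open>x\<close>,
  also where it diverges and both sides take the default value \<open>0\<close>.  It is therefore a Borel
  function of \<open>x\<close>, so that the outer integral may be taken over \<open>lborel\<close> as well.
\<close>

lemma integral_convolution_lebesgue:
  fixes f g :: "'a::euclidean_space \<Rightarrow> complex"
  assumes f: "integrable lebesgue f" and g: "integrable lebesgue g"
  shows "(LINT x|lebesgue. LINT t|lebesgue. f t * g (x - t)) =
    (LINT t|lebesgue. f t) * (LINT x|lebesgue. g x)"
proof -
  have fm[measurable]: "f \<in> borel_measurable lebesgue" and gm: "g \<in> borel_measurable lebesgue"
    using f g by auto
  obtain f' g' where f'm: "f' \<in> borel_measurable lborel" and f': "AE x in lborel. f x = f' x"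
    and g'm: "g' \<in> borel_measurable lborel" and g': "AE x in lborel. g x = g' x"
    using borel_representative_complex[OF fm] borel_representative_complex[OF gm] by blast
  have [measurable]: "f' \<in> borel_measurable borel" "g' \<in> borel_measurable borel"
    using f'm g'm by simp_all
  have intf': "integrable lborel f'"
    using f integrable_cong_AE[OF fm measurable_completion[OF f'm] AE_completion[OF f']]
    by (simp add: integrable_completion)
  have intg': "integrable lborel g'"
    using g integrable_cong_AE[OF gm measurable_completion[OF g'm] AE_completion[OF g']]
    by (simp add: integrable_completion)
  have inner: "(LINT t|lebesgue. f t * g (x - t)) = (LINT t|lborel. f' t * g' (x - t))" for x
  proof -
    have "(LINT t|lebesgue. f t * g (x - t)) = (LINT t|lebesgue. f' t * g' (x - t))"
    proof (rule integral_cong_AE)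
      show "(\<lambda>t. f t * g (x - t)) \<in> borel_measurable lebesgue"
        using borel_measurable_lebesgue_reflect[OF gm] by measurable
      show "(\<lambda>t. f' t * g' (x - t)) \<in> borel_measurable lebesgue"
        by (rule measurable_completion) measurable
      have "AE t in lborel. f t * g (x - t) = f' t * g' (x - t)"
        using f' AE_lborel_reflect[OF g', of x] by eventually_elim simp
      then show "AE t in lebesgue. f t * g (x - t) = f' t * g' (x - t)"
        by (rule AE_completion)
    qed
    also have "\<dots> = (LINT t|lborel. f' t * g' (x - t))"
      by (rule integral_completion) measurable
    finally show ?thesis .
  qed
  have "(LINT x|lebesgue. LINT t|lebesgue. f t * g (x - t)) =
      (LINT x|lborel. LINT t|lborel. f' t * g' (x - t))"
    unfolding inner by (rule integral_completion) measurable
  also have "\<dots> = (LINT t|lborel. f' t) * (LINT x|lborel. g' x)"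
    by (rule integral_convolution_lborel[OF intf' intg'])
  also have "(LINT t|lborel. f' t) = (LINT t|lebesgue. f t)"
    using integral_cong_AE[OF fm measurable_completion[OF f'm] AE_completion[OF f']]
      integral_completion[OF f'm] by simp
  also have "(LINT x|lborel. g' x) = (LINT x|lebesgue. g x)"
    using integral_cong_AE[OF gm measurable_completion[OF g'm] AE_completion[OF g']]
      integral_completion[OF g'm] by simp
  finally show ?thesis .
qed

section \<open>Splitting the kernel into a chirp and a character\<close>

definition fourier_char :: "('n::finite \<Rightarrow> qpft_param) \<Rightarrow> real ^ 'n \<Rightarrow> real ^ 'n \<Rightarrow> complex" where
  "fourier_char \<Lambda> \<omega> x =
     exp (\<i> * of_real (\<Sum>k\<in>UNIV. (pb (\<Lambda> k) * (\<omega> $ k) + pd (\<Lambda> k)) * (x $ k)))"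

definition output_phase :: "('n::finite \<Rightarrow> qpft_param) \<Rightarrow> real ^ 'n \<Rightarrow> complex" where
  "output_phase \<Lambda> \<omega> =
     exp (\<i> * of_real (\<Sum>k\<in>UNIV. pc (\<Lambda> k) * (\<omega> $ k)\<^sup>2 + pe (\<Lambda> k) * (\<omega> $ k)))"

definition kernel_const :: "('n::finite \<Rightarrow> qpft_param) \<Rightarrow> complex" where
  "kernel_const \<Lambda> = (\<Prod>k\<in>UNIV. csqrt (of_real (pb (\<Lambda> k)) / (2 * of_real pi * \<i>)))"

lemma qpft_kernel_split:
  "qpft_kernel \<Lambda> \<omega> x =
    kernel_const \<Lambda> * output_phase \<Lambda> \<omega> * (chirp \<Lambda> x * fourier_char \<Lambda> \<omega> x)"
  unfolding qpft_kernel_def kernel_const_def output_phase_def chirp_def fourier_char_def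
  by (simp add: prod.distrib exp_sum[symmetric] exp_add[symmetric] sum.distrib[symmetric]
      sum_distrib_left algebra_simps)

lemma fourier_char_add: "fourier_char \<Lambda> \<omega> (x + y) = fourier_char \<Lambda> \<omega> x * fourier_char \<Lambda> \<omega> y"
proof -
  have "(\<Sum>k\<in>UNIV. (pb (\<Lambda> k) * (\<omega> $ k) + pd (\<Lambda> k)) * ((x + y) $ k)) =
      (\<Sum>k\<in>UNIV. (pb (\<Lambda> k) * (\<omega> $ k) + pd (\<Lambda> k)) * (x $ k)) +
      (\<Sum>k\<in>UNIV. (pb (\<Lambda> k) * (\<omega> $ k) + pd (\<Lambda> k)) * (y $ k))"
    by (simp only: vector_add_component distrib_left sum.distrib)
  then show ?thesis
    unfolding fourier_char_def by (simp only: of_real_add distrib_left exp_add)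
qed

text \<open>
  This form reduces the claim to Fourier integrals of chirped functions, where the only factor
  besides the function itself is multiplicative under translation.
\<close>

lemma qpft_eq_chirped:
  "qpft \<Lambda> f \<omega> = kernel_const \<Lambda> * output_phase \<Lambda> \<omega> *
    (LINT x|lebesgue. fourier_char \<Lambda> \<omega> x * (f x * chirp \<Lambda> x))"
proof -
  have "qpft_kernel \<Lambda> \<omega> x * f x = kernel_const \<Lambda> * output_phase \<Lambda> \<omega> *
      (fourier_char \<Lambda> \<omega> x * (f x * chirp \<Lambda> x))" for x
    by (simp add: qpft_kernel_split mult_ac)
  then have "qpft \<Lambda> f \<omega> = (LINT x|lebesgue. kernel_const \<Lambda> * output_phase \<Lambda> \<omega> *
      (fourier_char \<Lambda> \<omega> x * (f x * chirp \<Lambda> x)))"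
    by (simp only: qpft_def)
  then show ?thesis
    by simp
qed

text \<open>
  Dividing by the positive real \<open>sqrt r\<close> does not leave the half plane of the principal square
  roots, so no change of branch occurs.
\<close>

lemma csqrt_divide_of_real:
  assumes "r > 0"
  shows "csqrt (z / of_real r) = csqrt z / of_real (sqrt r)"
proof (rule csqrt_unique)
  show "(csqrt z / of_real (sqrt r))\<^sup>2 = z / of_real r"
    using assms by (simp add: power_divide flip: of_real_power)
  show "0 < Re (csqrt z / of_real (sqrt r)) \<or>
      Re (csqrt z / of_real (sqrt r)) = 0 \<and> 0 \<le> Im (csqrt z / of_real (sqrt r))"
    using csqrt_principal[of z] assms
    by (simp only: Re_divide_of_real Im_divide_of_real) auto
qed

lemma kernel_const_eq:
  fixes \<Lambda> :: "'n::finite \<Rightarrow> qpft_param"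
  shows "(\<Prod>k\<in>UNIV. csqrt (of_real (pb (\<Lambda> k)) / \<i>)) / of_real (sqrt (2 * pi) ^ CARD('n)) =
    kernel_const \<Lambda>"
proof -
  have "csqrt (of_real (pb (\<Lambda> k)) / (2 * of_real pi * \<i>)) =
      csqrt (of_real (pb (\<Lambda> k)) / \<i>) / of_real (sqrt (2 * pi))" for k
  proof -
    have "of_real (pb (\<Lambda> k)) / (2 * of_real pi * \<i>) =
        of_real (pb (\<Lambda> k)) / \<i> / (of_real (2 * pi) :: complex)"
      by (simp add: divide_simps)
    then show ?thesis
      using csqrt_divide_of_real[of "2 * pi" "of_real (pb (\<Lambda> k)) / \<i>"] by (simp only:) simp
  qed
  then show ?thesis
    unfolding kernel_const_def by (simp add: prod_dividef)
qed

text \<open>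
  Chirp and character are continuous functions of modulus one, so the product is measurable and
  dominated by \<open>f\<close>.
\<close>

lemma integrable_chirped:
  fixes f :: "real ^ 'n::finite \<Rightarrow> complex"
  assumes f: "integrable lebesgue f"
  shows "integrable lebesgue (\<lambda>x. fourier_char \<Lambda> \<omega> x * (f x * chirp \<Lambda> x))"
proof (rule Bochner_Integration.integrable_bound[OF f])
  have "chirp \<Lambda> \<in> borel_measurable borel" "fourier_char \<Lambda> \<omega> \<in> borel_measurable borel"
    unfolding chirp_def fourier_char_def
    by (intro borel_measurable_continuous_onI continuous_intros)+
  then have [measurable]: "chirp \<Lambda> \<in> borel_measurable lebesgue"
    "fourier_char \<Lambda> \<omega> \<in> borel_measurable lebesgue"
    by (auto intro: measurable_completion)
  show "(\<lambda>x. fourier_char \<Lambda> \<omega> x * (f x * chirp \<Lambda> x)) \<in> borel_measurable lebesgue"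
    using borel_measurable_integrable[OF f] by measurable
  show "AE x in lebesgue. norm (fourier_char \<Lambda> \<omega> x * (f x * chirp \<Lambda> x)) \<le> norm (f x)"
    by (simp add: norm_mult chirp_def fourier_char_def)
qed

section \<open>The convolution theorem\<close>

theorem theorem3p6:
  fixes \<Lambda> :: "'n::finite \<Rightarrow> qpft_param"
    and f g :: "real ^ 'n \<Rightarrow> complex"
  assumes "\<And>k. pb (\<Lambda> k) \<noteq> 0"
    and "integrable lebesgue f"
    and "integrable lebesgue g"
  shows "\<forall>\<omega>. qpft \<Lambda> (qpft_convol \<Lambda> f g) \<omega> =
           exp (- \<i> * of_real (\<Sum>k\<in>UNIV. pc (\<Lambda> k) * (\<omega> $ k)\<^sup>2 + pe (\<Lambda> k) * (\<omega> $ k))) *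
           qpft \<Lambda> g \<omega> * qpft \<Lambda> f \<omega>"
proof
  fix \<omega> :: "real ^ 'n"
  define C where "C = kernel_const \<Lambda>"
  define P where "P = output_phase \<Lambda> \<omega>"
  define E where "E = fourier_char \<Lambda> \<omega>"
  define F where "F = (\<lambda>x. E x * (f x * chirp \<Lambda> x))"
  define G where "G = (\<lambda>x. E x * (g x * chirp \<Lambda> x))"
  have shift: "E x * convol (\<lambda>y. f y * chirp \<Lambda> y) (\<lambda>y. g y * chirp \<Lambda> y) x =
      1 / of_real (sqrt (2 * pi) ^ CARD('n)) * (LINT t|lebesgue. F t * G (x - t))" for x
  proof -
    \<comment> \<open>The character distributes over \<open>x = t + (x - t)\<close>, which moves it inside the convolution.\<close>
    have E: "E x = E t * E (x - t)" for t
      using fourier_char_add[of \<Lambda> \<omega> t "x - t"] by (simp add: E_def)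
    have "F t * G (x - t) =
        E x * (f t * chirp \<Lambda> t * (g (x - t) * chirp \<Lambda> (x - t)))" for t
      by (simp add: F_def G_def E[of t] mult_ac)
    then show ?thesis
      by (simp add: convol_def mult_ac)
  qed
  have "E x * (qpft_convol \<Lambda> f g x * chirp \<Lambda> x) = C * (LINT t|lebesgue. F t * G (x - t))" for x
  proof -
    have "exp (- \<i> * of_real (\<Sum>k\<in>UNIV. pa (\<Lambda> k) * (x $ k)\<^sup>2)) * chirp \<Lambda> x = 1"
      unfolding chirp_def by (simp add: exp_add[symmetric])
    moreover have "e * (p * q * w * h) = q * h * (p * (e * w))" for e p q w h :: complex
      by (simp add: mult_ac)
    ultimately have "E x * (qpft_convol \<Lambda> f g x * chirp \<Lambda> x) =
        (\<Prod>k\<in>UNIV. csqrt (of_real (pb (\<Lambda> k)) / \<i>)) *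
        (E x * convol (\<lambda>y. f y * chirp \<Lambda> y) (\<lambda>y. g y * chirp \<Lambda> y) x)"
      unfolding qpft_convol_def by (simp only: mult_1)
    then show ?thesis
      unfolding shift C_def kernel_const_eq[symmetric] by simp
  qed
  then have "qpft \<Lambda> (qpft_convol \<Lambda> f g) \<omega> =
      C * P * (C * (LINT x|lebesgue. LINT t|lebesgue. F t * G (x - t)))"
    by (simp add: qpft_eq_chirped C_def P_def E_def)
  also have "(LINT x|lebesgue. LINT t|lebesgue. F t * G (x - t)) =
      (LINT x|lebesgue. F x) * (LINT x|lebesgue. G x)"
    unfolding F_def G_def E_def
    by (intro integral_convolution_lebesgue integrable_chirped assms)
  also have "C * P * (C * ((LINT x|lebesgue. F x) * (LINT x|lebesgue. G x))) =
      inverse P * (C * P * (LINT x|lebesgue. G x)) * (C * P * (LINT x|lebesgue. F x))"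
    by (simp add: P_def output_phase_def)
  also have "inverse P =
      exp (- \<i> * of_real (\<Sum>k\<in>UNIV. pc (\<Lambda> k) * (\<omega> $ k)\<^sup>2 + pe (\<Lambda> k) * (\<omega> $ k)))"
    by (simp add: P_def output_phase_def exp_minus)
  also have "C * P * (LINT x|lebesgue. G x) = qpft \<Lambda> g \<omega>"
    by (simp add: qpft_eq_chirped C_def P_def G_def E_def)
  also have "C * P * (LINT x|lebesgue. F x) = qpft \<Lambda> f \<omega>"
    by (simp add: qpft_eq_chirped C_def P_def F_def E_def)
  finally show "qpft \<Lambda> (qpft_convol \<Lambda> f g) \<omega> =
      exp (- \<i> * of_real (\<Sum>k\<in>UNIV. pc (\<Lambda> k) * (\<omega> $ k)\<^sup>2 + pe (\<Lambda> k) * (\<omega> $ k))) *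
      qpft \<Lambda> g \<omega> * qpft \<Lambda> f \<omega>" .
qed

end
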